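(* Let $G$ be a finitely generated group with word metric $d$ coming from a fixed finite generating set, and let $\mathrm{len}(g)=d(g,1)$. (1) Suppose there exists $t\in\mathbb{R}$ such that for all $g\in G$ with $g\ne 1$ the complex $D_t(\{g\})$ is connected, and for all $g,g'\in G$ with $d(g,g')=t$ and $\mathrm{len}(g)=\mathrm{len}(g')$ the complex $D_t(\{g,g'\})$ is non-empty. Then $G$ is finitely presented. (2) If the Cayley graph of $G$ (with respect to the fixed generating set) has no odd-length cycles, then $G$ is finitely presented as soon as there exists some odd $t\in\mathbb{N}$ such that $D_t(\{g\})$ is connected for all $g\in G$ with $g\neq 1$.
   Context: The word metric is $d(g,h)=$ the word length of $g^{-1}h$. For non-empty finite $S\subseteq G$, $\mathrm{diam}(S)=\max\{d(g,g'):g,g'\in S\}$ and $\mathrm{len}_{\min}(S)=\min\{\mathrm{len}(g):g\in S\}$. $D_t(S)$ is the geometric realization of the poset (under inclusion) of all finite $S'\subseteq G$ with $S'\supsetneq S$, $\mathrm{diam}(S')\le t$ and $\mathrm{len}_{\min}(S')<\mathrm{len}_{\min}(S)$; the geometric realization of a poset is the simplicial complex whose simplices are the finite non-empty chains of the poset. "Connected" means $0$-connected: non-empty and path-connected.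
   Formalization: In (1) the second condition is required for pairs with d(g,g') = ⌊t⌋ instead of d(g,g') = t; this is the same for integer t, while for non-integer t the literal condition is vacuous and the claim fails (t = 2.5, lamplighter group). *)

theory Defs
  imports
    "HOL-Analysis.Analysis"
    "HOL-Algebra.Generated_Groups"
    "Graph_Theory.Arc_Walk"
begin

section \<open>Word metric and Cayley graph\<close>

definition word_length :: "('a, 'm) monoid_scheme \<Rightarrow> 'a set \<Rightarrow> 'a \<Rightarrow> nat" where
  "word_length G A g =
     (LEAST n. \<exists>w. length w = n \<and> set w \<subseteq> A \<union> m_inv G ` A \<and> foldr (\<otimes>\<^bsub>G\<^esub>) w \<one>\<^bsub>G\<^esub> = g)"

definition word_dist :: "('a, 'm) monoid_scheme \<Rightarrow> 'a set \<Rightarrow> 'a \<Rightarrow> 'a \<Rightarrow> nat" where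
  "word_dist G A g h = word_length G A (inv\<^bsub>G\<^esub> g \<otimes>\<^bsub>G\<^esub> h)"

definition len :: "('a, 'm) monoid_scheme \<Rightarrow> 'a set \<Rightarrow> 'a \<Rightarrow> nat" where
  "len G A g = word_dist G A g \<one>\<^bsub>G\<^esub>"

definition diam :: "('a, 'm) monoid_scheme \<Rightarrow> 'a set \<Rightarrow> 'a set \<Rightarrow> nat" where
  "diam G A S = Max {word_dist G A g g' | g g'. g \<in> S \<and> g' \<in> S}"

definition len_min :: "('a, 'm) monoid_scheme \<Rightarrow> 'a set \<Rightarrow> 'a set \<Rightarrow> nat" where
  "len_min G A S = Min (len G A ` S)"

text \<open>
  The undirected Cayley graph, as a symmetric digraph: an edge is a pair of opposite arcs.
  A closed walk back and forth along an edge counts as a (directed) cycle of length 2; this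
  has no effect on the existence of cycles of odd length.  The graph is simple: the identity, if
  it belongs to the generating set, gives no loops.
\<close>

definition cayley_graph ::
    "('a, 'm) monoid_scheme \<Rightarrow> 'a set \<Rightarrow> ('a, 'a \<times> 'a) pre_digraph" where
  "cayley_graph G A =
     \<lparr>verts = carrier G,
      arcs = {(g, h). g \<in> carrier G \<and> h \<in> carrier G \<and> g \<noteq> h \<and>
                      (\<exists>x\<in>A. h = g \<otimes>\<^bsub>G\<^esub> x \<or> g = h \<otimes>\<^bsub>G\<^esub> x)},
      tail = fst, head = snd\<rparr>"

section \<open>Geometric realizations\<close>

text \<open>Barycentric coordinates, as a subset of the function space with its product topology.\<close>

definition closed_simplex :: "'v set \<Rightarrow> ('v \<Rightarrow> real) set" where
  "closed_simplex \<sigma> = {f. (\<forall>v. 0 \<le> f v) \<and> (\<forall>v. v \<notin> \<sigma> \<longrightarrow> f v = 0) \<and> sum f \<sigma> = 1}"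

text \<open>The weak topology determined by the closed simplices of the simplicial complex \<open>K\<close>.\<close>

definition realization :: "'v set set \<Rightarrow> ('v \<Rightarrow> real) topology" where
  "realization K = topology (\<lambda>U. U \<subseteq> \<Union> (closed_simplex ` K) \<and>
     (\<forall>\<sigma>\<in>K. openin (top_of_set (closed_simplex \<sigma>)) (U \<inter> closed_simplex \<sigma>)))"

lemma openin_realization:
  "openin (realization K) U \<longleftrightarrow> U \<subseteq> \<Union> (closed_simplex ` K) \<and>
     (\<forall>\<sigma>\<in>K. openin (top_of_set (closed_simplex \<sigma>)) (U \<inter> closed_simplex \<sigma>))"
proof -
  let ?L = "\<lambda>U. U \<subseteq> \<Union> (closed_simplex ` K) \<and>
     (\<forall>\<sigma>\<in>K. openin (top_of_set (closed_simplex \<sigma>)) (U \<inter> closed_simplex \<sigma>))"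
  have "istopology ?L"
    unfolding istopology_def
  proof (intro conjI allI impI ballI)
    fix S T \<sigma> assume "?L S" "?L T" "\<sigma> \<in> K"
    then have "openin (top_of_set (closed_simplex \<sigma>))
        ((S \<inter> closed_simplex \<sigma>) \<inter> (T \<inter> closed_simplex \<sigma>))"
      by (blast intro: openin_Int)
    then show "openin (top_of_set (closed_simplex \<sigma>)) (S \<inter> T \<inter> closed_simplex \<sigma>)"
      by (simp add: Int_ac)
  next
    fix \<U> \<sigma> assume "\<forall>U\<in>\<U>. ?L U" "\<sigma> \<in> K"
    then have "openin (top_of_set (closed_simplex \<sigma>)) (\<Union> ((\<lambda>U. U \<inter> closed_simplex \<sigma>) ` \<U>))"
      by (intro openin_Union) blast
    then show "openin (top_of_set (closed_simplex \<sigma>)) (\<Union> \<U> \<inter> closed_simplex \<sigma>)"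
      by (metis Int_Union2)
  qed blast+
  then show ?thesis
    by (simp add: realization_def topology_inverse')
qed

lemma topspace_realization: "topspace (realization K) = \<Union> (closed_simplex ` K)"
proof (rule antisym)
  show "topspace (realization K) \<subseteq> \<Union> (closed_simplex ` K)"
    using openin_topspace[of "realization K"] openin_realization by blast
  have "\<Union> (closed_simplex ` K) \<inter> closed_simplex \<sigma> = closed_simplex \<sigma>" if "\<sigma> \<in> K" for \<sigma>
    using that by blast
  then have "openin (realization K) (\<Union> (closed_simplex ` K))"
    by (simp add: openin_realization)
  then show "\<Union> (closed_simplex ` K) \<subseteq> topspace (realization K)"
    by (rule openin_subset)
qed

definition order_complex :: "'p::order set \<Rightarrow> 'p set set" where
  "order_complex P = {C. C \<subseteq> P \<and> finite C \<and> C \<noteq> {} \<and> Complete_Partial_Order.chain (\<le>) C}"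

definition zero_connected :: "'a topology \<Rightarrow> bool" where
  "zero_connected T \<longleftrightarrow> topspace T \<noteq> {} \<and> path_connected_space T"

section \<open>The complexes \<open>D\<^sub>t(S)\<close>\<close>

text \<open>
  The word metric takes values in the natural numbers, so \<open>D\<^sub>t(S)\<close> depends only on the integer
  part of \<open>t\<close>, which is the largest diameter allowed.
\<close>

definition D_poset :: "('a, 'm) monoid_scheme \<Rightarrow> 'a set \<Rightarrow> real \<Rightarrow> 'a set \<Rightarrow> 'a set set" where
  "D_poset G A t S = {S'. finite S' \<and> S' \<subseteq> carrier G \<and> S \<subset> S' \<and>
     real (diam G A S') \<le> t \<and> len_min G A S' < len_min G A S}"

definition D_complex ::
    "('a, 'm) monoid_scheme \<Rightarrow> 'a set \<Rightarrow> real \<Rightarrow> 'a set \<Rightarrow> ('a set \<Rightarrow> real) topology" where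
  "D_complex G A t S = realization (order_complex (D_poset G A t S))"

section \<open>Finitely presented groups\<close>

text \<open>The letter \<open>(x, True)\<close> stands for \<open>x\<close> and \<open>(x, False)\<close> for its formal inverse.\<close>

definition words :: "'x set \<Rightarrow> ('x \<times> bool) list set" where
  "words Y = lists (Y \<times> UNIV)"

inductive_set free_rel :: "'x set \<Rightarrow> (('x \<times> bool) list \<times> ('x \<times> bool) list) set"
  for Y :: "'x set" where
  refl: "u \<in> words Y \<Longrightarrow> (u, u) \<in> free_rel Y"
| sym: "(u, v) \<in> free_rel Y \<Longrightarrow> (v, u) \<in> free_rel Y"
| trans: "(u, v) \<in> free_rel Y \<Longrightarrow> (v, w) \<in> free_rel Y \<Longrightarrow> (u, w) \<in> free_rel Y"
| cancel: "u \<in> words Y \<Longrightarrow> v \<in> words Y \<Longrightarrow> x \<in> Y \<Longrightarrow>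
    (u @ [(x, b), (x, \<not> b)] @ v, u @ v) \<in> free_rel Y"

definition free_group :: "'x set \<Rightarrow> ('x \<times> bool) list set monoid" where
  "free_group Y =
     \<lparr>carrier = words Y // free_rel Y,
      mult = (\<lambda>A B. \<Union>u\<in>A. \<Union>v\<in>B. free_rel Y `` {u @ v}),
      one = free_rel Y `` {[]}\<rparr>"

lemma words_Nil: "[] \<in> words Y"
  and words_append: "u @ v \<in> words Y \<longleftrightarrow> u \<in> words Y \<and> v \<in> words Y"
  by (auto simp: words_def)

lemma free_rel_words: "(u, v) \<in> free_rel Y \<Longrightarrow> u \<in> words Y \<and> v \<in> words Y"
  by (induction rule: free_rel.induct) (auto simp: words_def)

lemma equiv_free_rel: "equiv (words Y) (free_rel Y)"
proof (rule equivI)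
  show "free_rel Y \<subseteq> words Y \<times> words Y"
    using free_rel_words by fast
  show "refl_on (words Y) (free_rel Y)"
    by (simp add: refl_on_def free_rel.refl)
  show "sym (free_rel Y)" "trans (free_rel Y)"
    by (rule symI, erule free_rel.sym) (rule transI, erule free_rel.trans)
qed

lemma free_rel_append_right:
  "(u, u') \<in> free_rel Y \<Longrightarrow> w \<in> words Y \<Longrightarrow> (u @ w, u' @ w) \<in> free_rel Y"
proof (induction rule: free_rel.induct)
  case (cancel u v x b)
  then show ?case
    using free_rel.cancel[of u Y "v @ w" x b] by (simp add: words_append)
next
  case (trans u v v')
  then show ?case by (meson free_rel.trans)
qed (simp_all add: words_append free_rel.refl free_rel.sym)

lemma free_rel_append_left:
  "(u, u') \<in> free_rel Y \<Longrightarrow> w \<in> words Y \<Longrightarrow> (w @ u, w @ u') \<in> free_rel Y"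
proof (induction rule: free_rel.induct)
  case (cancel u v x b)
  then show ?case
    using free_rel.cancel[of "w @ u" Y v x b] by (simp add: words_append)
next
  case (trans u v v')
  then show ?case by (meson free_rel.trans)
qed (simp_all add: words_append free_rel.refl free_rel.sym)

lemma free_rel_append:
  assumes "(u, u') \<in> free_rel Y" "(v, v') \<in> free_rel Y"
  shows "(u @ v, u' @ v') \<in> free_rel Y"
proof (rule free_rel.trans)
  show "(u @ v, u' @ v) \<in> free_rel Y"
    using assms free_rel_words free_rel_append_right by fast
  show "(u' @ v, u' @ v') \<in> free_rel Y"
    using assms free_rel_words free_rel_append_left by fast
qed

lemma free_group_mult:
  assumes "u \<in> words Y" "v \<in> words Y"
  shows "free_rel Y `` {u} \<otimes>\<^bsub>free_group Y\<^esub> free_rel Y `` {v} = free_rel Y `` {u @ v}"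
proof -
  have "congruent2 (free_rel Y) (free_rel Y) (\<lambda>u v. free_rel Y `` {u @ v})"
    by (rule congruent2I', rule equiv_class_eq[OF equiv_free_rel], rule free_rel_append)
  then show ?thesis
    using UN_equiv_class2[OF equiv_free_rel equiv_free_rel _ assms] by (simp add: free_group_def)
qed

definition word_inv :: "('x \<times> bool) list \<Rightarrow> ('x \<times> bool) list" where
  "word_inv w = rev (map (\<lambda>(x, b). (x, \<not> b)) w)"

lemma word_inv_words: "w \<in> words Y \<Longrightarrow> word_inv w \<in> words Y"
  by (auto simp: words_def word_inv_def)

lemma free_rel_inv:
  "w \<in> words Y \<Longrightarrow> (word_inv w @ w, []) \<in> free_rel Y"
proof (induction w)
  case Nil
  then show ?case by (simp add: word_inv_def free_rel.refl)
next
  case (Cons a w)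
  obtain x b where a: "a = (x, b)" by force
  from Cons.prems a have x: "x \<in> Y" and w: "w \<in> words Y" by (auto simp: words_def)
  have "(word_inv w @ [(x, \<not> b), (x, \<not> \<not> b)] @ w, word_inv w @ w) \<in> free_rel Y"
    by (rule free_rel.cancel[OF word_inv_words[OF w] w x])
  from free_rel.trans[OF this Cons.IH[OF w]] show ?case
    by (simp add: a word_inv_def)
qed

lemma group_free_group: "group (free_group Y)"
proof (rule groupI)
  have C: "A \<in> carrier (free_group Y) \<longleftrightarrow> (\<exists>u\<in>words Y. A = free_rel Y `` {u})" for A
    by (auto simp: free_group_def quotient_def)
  have one: "\<one>\<^bsub>free_group Y\<^esub> = free_rel Y `` {[]}"
    by (simp add: free_group_def)
  show "\<one>\<^bsub>free_group Y\<^esub> \<in> carrier (free_group Y)"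
    unfolding C one using words_Nil by blast
  fix A assume "A \<in> carrier (free_group Y)"
  then obtain u where u: "u \<in> words Y" "A = free_rel Y `` {u}" unfolding C by blast
  show "\<one>\<^bsub>free_group Y\<^esub> \<otimes>\<^bsub>free_group Y\<^esub> A = A"
    by (simp add: u one free_group_mult words_Nil)
  have "free_rel Y `` {word_inv u} \<otimes>\<^bsub>free_group Y\<^esub> A = \<one>\<^bsub>free_group Y\<^esub>"
    unfolding u(2) one free_group_mult[OF word_inv_words[OF u(1)] u(1)]
    by (rule equiv_class_eq[OF equiv_free_rel free_rel_inv[OF u(1)]])
  then show "\<exists>B\<in>carrier (free_group Y). B \<otimes>\<^bsub>free_group Y\<^esub> A = \<one>\<^bsub>free_group Y\<^esub>"
    by (rule bexI) (use word_inv_words[OF u(1)] C in blast)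
  fix B assume "B \<in> carrier (free_group Y)"
  then obtain v where v: "v \<in> words Y" "B = free_rel Y `` {v}" unfolding C by blast
  show "A \<otimes>\<^bsub>free_group Y\<^esub> B \<in> carrier (free_group Y)"
    unfolding C using u v by (auto simp: free_group_mult words_append)
  fix D assume "D \<in> carrier (free_group Y)"
  then obtain w where w: "w \<in> words Y" "D = free_rel Y `` {w}" unfolding C by blast
  show "A \<otimes>\<^bsub>free_group Y\<^esub> B \<otimes>\<^bsub>free_group Y\<^esub> D
      = A \<otimes>\<^bsub>free_group Y\<^esub> (B \<otimes>\<^bsub>free_group Y\<^esub> D)"
    using u v w by (simp add: free_group_mult words_append)
qed

definition normal_closure :: "('a, 'm) monoid_scheme \<Rightarrow> 'a set \<Rightarrow> 'a set" where
  "normal_closure F R = \<Inter> {N. N \<lhd> F \<and> R \<subseteq> N}"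

text \<open>The generators of a finite presentation may be taken to be natural numbers.\<close>

definition finitely_presented :: "('a, 'm) monoid_scheme \<Rightarrow> bool" where
  "finitely_presented G \<longleftrightarrow>
     (\<exists>(Y :: nat set) R. finite Y \<and> finite R \<and> R \<subseteq> carrier (free_group Y) \<and>
        G \<cong> free_group Y Mod normal_closure (free_group Y) R)"

end

theory Submission
  imports Defs
begin

text \<open>
  Take the elements of length at most \<open>t\<close> as generators and the triangles among them as relators. Any
  map \<open>\<psi>\<close> on these elements that respects triangles, with values in a group \<open>H\<close>, is
  integrated to a function \<open>f\<close> on \<open>G\<close> with \<open>f (g b) = f g \<psi>(b)\<close>, by recursion on
  the length: \<open>f g = f h \<psi>(h\<inverse> g)\<close> for any \<open>h\<close> shorter than \<open>g\<close> within distance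
  \<open>t\<close>. Two such \<open>h\<close> are joined by a sequence of them whose successive members span triangles
  with \<open>g\<close>, because \<open>D\<^sub>t({g})\<close> is connected. Two elements of equal length within distance
  \<open>t\<close> have a common shorter neighbour: a member of a vertex of \<open>D\<^sub>t({g, g'})\<close> if their distance is
  \<open>t\<close>, and otherwise the predecessor of \<open>g\<close> on a geodesic from \<open>\<one>\<close>. With
  \<open>H\<close> the presented group, a word with value \<open>\<one>\<close> in \<open>G\<close> is therefore trivial in
  \<open>H\<close>. If all cycles of the Cayley graph are even, elements of equal length are at even
  distance, so distance \<open>t\<close> does not occur for odd \<open>t\<close>.
\<close>

section \<open>Connected order complexes\<close>

text \<open>A coordinate function supported on \<open>\<tau>\<close> vanishes on
  \<open>\<sigma>\<close>, so its sum over \<open>\<sigma>\<close> is 0 instead of 1.\<close>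

lemma closed_simplex_disjoint:
  assumes "\<sigma> \<inter> \<tau> = {}"
  shows "closed_simplex \<sigma> \<inter> closed_simplex \<tau> = {}"
proof -
  have "sum f \<sigma> = 0" if "f \<in> closed_simplex \<tau>" for f
    using that assms by (intro sum.neutral) (auto simp: closed_simplex_def)
  then show ?thesis
    by (fastforce simp: closed_simplex_def)
qed

lemma closed_simplex_vertex:
  assumes "finite \<sigma>"
  shows "(\<lambda>w. if w = v then 1 else 0) \<in> closed_simplex \<sigma> \<longleftrightarrow> v \<in> \<sigma>"
  using assms by (auto simp: closed_simplex_def)

lemma realization_order_complex_nonempty:
  assumes "topspace (realization (order_complex P)) \<noteq> {}"
  shows "P \<noteq> {}"
  using assms by (auto simp: topspace_realization order_complex_def)

text \<open>
  A union of comparability classes spans a clopen subset, since a chain meeting it lies inside it.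
\<close>
lemma zero_connected_order_complex_components:
  fixes P :: "'p::order set"
  assumes conn: "zero_connected (realization (order_complex P))"
    and "C \<subseteq> P" "c \<in> C"
    and up: "\<And>x y. x \<in> C \<Longrightarrow> y \<in> P \<Longrightarrow> x \<le> y \<Longrightarrow> y \<in> C"
    and down: "\<And>x y. x \<in> C \<Longrightarrow> y \<in> P \<Longrightarrow> y \<le> x \<Longrightarrow> y \<in> C"
  shows "C = P"
proof -
  let ?K = "order_complex P"
  let ?v = "\<lambda>p w. if w = p then (1::real) else 0"
  have dich: "\<sigma> \<subseteq> C \<or> \<sigma> \<subseteq> P - C" if "\<sigma> \<in> ?K" for \<sigma>
    using that up down unfolding order_complex_def chain_def by blast
  \<comment> \<open>\<open>U E\<close> is the union of the simplices with all vertices in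
    \<open>E\<close>. By \<open>dich\<close> the sets for \<open>C\<close> and \<open>P - C\<close>
    cover the realization.\<close>
  define U where "U E = \<Union> (closed_simplex ` {\<sigma> \<in> ?K. \<sigma> \<subseteq> E})" for E
  have disj: "closed_simplex \<sigma> \<inter> closed_simplex \<tau> = {}"
    if "\<sigma> \<subseteq> C" "\<tau> \<subseteq> P - C" for \<sigma> \<tau>
    using that by (intro closed_simplex_disjoint) blast
  \<comment> \<open>Openness in the weak topology is tested on each simplex, where the trace of
    \<open>U E\<close> is everything or empty.\<close>
  have "openin (realization ?K) (U E)" if E: "E = C \<or> E = P - C" for E
    unfolding openin_realization
  proof (intro conjI ballI)
    show "U E \<subseteq> \<Union> (closed_simplex ` ?K)"
      unfolding U_def by blast
    fix \<sigma> assume \<sigma>: "\<sigma> \<in> ?K"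
    show "openin (top_of_set (closed_simplex \<sigma>)) (U E \<inter> closed_simplex \<sigma>)"
    proof (cases "\<sigma> \<subseteq> E")
      case True
      then have "U E \<inter> closed_simplex \<sigma> = closed_simplex \<sigma>"
        using \<sigma> unfolding U_def by blast
      then show ?thesis by simp
    next
      case False
      then have "U E \<inter> closed_simplex \<sigma> = {}"
        using dich[OF \<sigma>] E disj unfolding U_def by blast
      then show ?thesis by (simp only: openin_empty)
    qed
  qed
  then have openin: "openin (realization ?K) (U C)" "openin (realization ?K) (U (P - C))"
    by blast+
  have cover: "topspace (realization ?K) \<subseteq> U C \<union> U (P - C)"
    unfolding topspace_realization U_def using dich by blast
  have disjoint: "U C \<inter> U (P - C) = {}"
    unfolding U_def using disj by blast
  have connected: "connected_space (realization ?K)"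
    using conn path_connected_imp_connected_space unfolding zero_connected_def by blast
  \<comment> \<open>Turns an element of \<open>E\<close> into a point of \<open>U E\<close>. It is
    used for \<open>C\<close> and, once \<open>U (P - C)\<close> is known to be empty, for
    \<open>P - C\<close>.\<close>
  have vertex: "?v p \<in> U E" if "p \<in> E" "E \<subseteq> P" for p E
  proof -
    have "{p} \<in> ?K" "{p} \<subseteq> E"
      using that by (auto simp: order_complex_def chain_def)
    moreover have "?v p \<in> closed_simplex {p}"
      by (simp add: closed_simplex_vertex)
    ultimately show ?thesis unfolding U_def by blast
  qed
  have "U C \<noteq> {}"
    using vertex[OF \<open>c \<in> C\<close> \<open>C \<subseteq> P\<close>] by blast
  then have "U (P - C) = {}"
    using connected openin cover disjoint unfolding connected_space_def by metis
  then show ?thesis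
    using vertex[of _ "P - C"] \<open>C \<subseteq> P\<close> by blast
qed

section \<open>Odd cycles\<close>

text \<open>At a repeated vertex a closed walk splits into two shorter closed walks whose lengths
  add up to the original one, so one of them is odd.\<close>

lemma (in wf_digraph) odd_closed_walk_imp_odd_cycle:
  assumes "awalk u p u" "odd (length p)"
  shows "\<exists>c. cycle c \<and> odd (length c)"
  using assms
proof (induction "length p" arbitrary: p u rule: less_induct)
  case less
  show ?case
  proof (cases "distinct (tl (awalk_verts u p))")
    case True
    then show ?thesis
      using less.prems unfolding cycle_def by fastforce
  next
    case False
    \<comment> \<open>The first arc is set aside because the return to the start vertex is no
      repetition; this also makes the piece \<open>r\<close> strictly shorter than
      \<open>p\<close>.\<close>
    obtain e p' where p: "p = e # p'"
      using less.prems by (cases p) auto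
    have p': "awalk (head G e) p' u" "\<not> distinct (awalk_verts (head G e) p')"
      using False less.prems by (auto simp: p awalk_Cons_iff)
    obtain q r s x where wd: "p' = q @ r @ s" "0 < length r"
      "awalk (head G e) q x" "awalk x r x" "awalk x s u"
      using awalk_not_distinct_decomp[OF p'] by blast
    show ?thesis
    proof (cases "odd (length r)")
      case True
      then show ?thesis
        using less.hyps[of r x] wd p by simp
    next
      case False
      have "awalk u (e # q @ s) u"
        using wd less.prems by (auto simp: p awalk_Cons_iff)
      then show ?thesis
        using less.hyps[of "e # q @ s" u] less.prems False wd p by simp
    qed
  qed
qed

section \<open>A criterion for finite presentability\<close>

primrec letter_value :: "('a, 'm) monoid_scheme \<Rightarrow> ('x \<Rightarrow> 'a) \<Rightarrow> 'x \<times> bool \<Rightarrow> 'a" where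
  "letter_value G e (x, b) = (if b then e x else inv\<^bsub>G\<^esub> e x)"

definition free_value :: "('a, 'm) monoid_scheme \<Rightarrow> ('x \<Rightarrow> 'a) \<Rightarrow> ('x \<times> bool) list \<Rightarrow> 'a" where
  "free_value G e w = foldr (\<lambda>l. (\<otimes>\<^bsub>G\<^esub>) (letter_value G e l)) w \<one>\<^bsub>G\<^esub>"

text \<open>The value is read off an arbitrary representative; \<open>free_value_cong\<close> shows
  that the choice is immaterial.\<close>

definition free_lift ::
    "'x set \<Rightarrow> ('a, 'm) monoid_scheme \<Rightarrow> ('x \<Rightarrow> 'a) \<Rightarrow> ('x \<times> bool) list set \<Rightarrow> 'a" where
  "free_lift Y G e C = free_value G e (SOME w. w \<in> C)"

context group
begin

lemma free_value_Nil [simp]: "free_value G e [] = \<one>"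
  and free_value_Cons [simp]: "free_value G e (l # w) = letter_value G e l \<otimes> free_value G e w"
  by (simp_all add: free_value_def)

context
  fixes Y :: "'x set" and e :: "'x \<Rightarrow> 'a"
  assumes e_closed: "e ` Y \<subseteq> carrier G"
begin

lemma free_value_closed: "w \<in> words Y \<Longrightarrow> free_value G e w \<in> carrier G"
  using e_closed by (induction w) (auto simp: words_def)

lemma free_value_append:
  "u \<in> words Y \<Longrightarrow> v \<in> words Y \<Longrightarrow> free_value G e (u @ v) = free_value G e u \<otimes> free_value G e v"
proof (induction u)
  case (Cons l u)
  then have "u \<in> words Y" "letter_value G e l \<in> carrier G"
    using e_closed by (auto simp: words_def)
  then show ?case
    using Cons by (simp add: free_value_closed m_assoc)
qed (simp add: free_value_closed)

text \<open>Only cancellation has content: a letter followed by its formal inverse evaluates to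
  \<open>\<one>\<close>.\<close>

lemma free_value_cong: "(u, v) \<in> free_rel Y \<Longrightarrow> free_value G e u = free_value G e v"
proof (induction rule: free_rel.induct)
  case (cancel u v x b)
  then have "e x \<in> carrier G" "[(x, b), (x, \<not> b)] \<in> words Y"
    using e_closed by (auto simp: words_def)
  then have "free_value G e ([(x, b), (x, \<not> b)] @ v) = free_value G e v"
    using cancel free_value_closed[of v] by (cases b) (auto simp: m_assoc[symmetric])
  moreover have "[(x, b), (x, \<not> b)] @ v \<in> words Y"
    using cancel by (auto simp: words_def)
  ultimately show ?case
    using cancel free_value_append[of u] by metis
qed auto

lemma free_lift_class: "w \<in> words Y \<Longrightarrow> free_lift Y G e (free_rel Y `` {w}) = free_value G e w"
proof -
  assume w: "w \<in> words Y"
  then have "w \<in> free_rel Y `` {w}" by (simp add: free_rel.refl)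
  then have "(SOME v. v \<in> free_rel Y `` {w}) \<in> free_rel Y `` {w}" by (rule someI)
  then show ?thesis
    unfolding free_lift_def using free_value_cong by fastforce
qed

lemma free_lift_hom: "group_hom (free_group Y) G (free_lift Y G e)"
proof (intro group_hom.intro group_hom_axioms.intro group_free_group is_group homI)
  have C: "\<exists>u\<in>words Y. X = free_rel Y `` {u}" if "X \<in> carrier (free_group Y)" for X
    using that by (auto simp: free_group_def quotient_def)
  fix X assume "X \<in> carrier (free_group Y)"
  then obtain u where u: "u \<in> words Y" "X = free_rel Y `` {u}" using C by blast
  then show "free_lift Y G e X \<in> carrier G"
    by (simp add: free_lift_class free_value_closed)
  fix Z assume "Z \<in> carrier (free_group Y)"
  then obtain v where "v \<in> words Y" "Z = free_rel Y `` {v}" using C by blast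
  then show "free_lift Y G e (X \<otimes>\<^bsub>free_group Y\<^esub> Z) = free_lift Y G e X \<otimes> free_lift Y G e Z"
    using u by (simp add: free_group_mult free_lift_class free_value_append words_append)
qed

end

text \<open>
  The extension property is needed only when \<open>H\<close> is a quotient of the free group on a set of
  naturals, which fixes the type of \<open>H\<close>.
\<close>
lemma finitely_presentedI:
  assumes "finite B" "B \<subseteq> carrier G" "generate G B = carrier G"
    and extend: "\<And>(H :: (nat \<times> bool) list set set monoid) \<psi>. group H \<Longrightarrow>
      (\<And>b. b \<in> B \<Longrightarrow> \<psi> b \<in> carrier H) \<Longrightarrow>
      (\<And>b c. b \<in> B \<Longrightarrow> c \<in> B \<Longrightarrow> b \<otimes> c \<in> B \<Longrightarrow> \<psi> (b \<otimes> c) = \<psi> b \<otimes>\<^bsub>H\<^esub> \<psi> c) \<Longrightarrow>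
      \<exists>f. f \<one> = \<one>\<^bsub>H\<^esub> \<and> (\<forall>g\<in>carrier G. f g \<in> carrier H) \<and>
        (\<forall>g\<in>carrier G. \<forall>b\<in>B. f (g \<otimes> b) = f g \<otimes>\<^bsub>H\<^esub> \<psi> b)"
  shows "finitely_presented G"
proof -
  \<comment> \<open>Indices serve as generators, since \<open>finitely_presented\<close> asks for
    natural numbers; \<open>e\<close> names the elements of \<open>B\<close>.\<close>
  define Y where "Y = {..<card B}"
  obtain e where e: "bij_betw e Y B"
    using ex_bij_betw_nat_finite[OF \<open>finite B\<close>] by (auto simp: Y_def atLeast0LessThan)
  then have eB: "e x \<in> B" if "x \<in> Y" for x
    using that by (auto simp: bij_betw_def)
  then have e_closed: "e ` Y \<subseteq> carrier G" using \<open>B \<subseteq> carrier G\<close> by blast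
  let ?F = "free_group Y" and ?cl = "\<lambda>w. free_rel Y `` {w}" and ?\<phi> = "free_lift Y G e"
  interpret \<phi>: group_hom ?F G ?\<phi> using e_closed by (rule free_lift_hom)
  have carrier_F: "X \<in> carrier ?F \<longleftrightarrow> (\<exists>w\<in>words Y. X = ?cl w)" for X
    by (auto simp: free_group_def quotient_def)
  have one_F: "\<one>\<^bsub>?F\<^esub> = ?cl []" by (simp add: free_group_def)
  define rel where "rel x y z = [(x, True), (y, True), (z, False)]" for x y z :: nat
  \<comment> \<open>The relators record the part of the multiplication table of \<open>G\<close>
    that stays inside \<open>B\<close>.\<close>
  define R where "R = (\<lambda>(x, y, z). ?cl (rel x y z)) ` {(x, y, z) \<in> Y \<times> Y \<times> Y. e x \<otimes> e y = e z}"
  have rel_words: "rel x y z \<in> words Y" if "x \<in> Y" "y \<in> Y" "z \<in> Y" for x y z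
    using that by (simp add: rel_def words_def)
  have R: "finite R" "R \<subseteq> carrier ?F"
  proof -
    show "finite R"
      unfolding R_def
      by (rule finite_imageI, rule finite_subset[of _ "Y \<times> Y \<times> Y"]) (auto simp: Y_def)
    show "R \<subseteq> carrier ?F"
      using rel_words unfolding R_def subset_iff carrier_F by fast
  qed
  have "?\<phi> ` carrier ?F = carrier G"
  proof
    show "?\<phi> ` carrier ?F \<subseteq> carrier G" by auto
    have "B \<subseteq> ?\<phi> ` carrier ?F"
    proof
      fix b assume "b \<in> B"
      then obtain x where x: "x \<in> Y" "e x = b" using e by (auto simp: bij_betw_def)
      have w: "[(x, True)] \<in> words Y" using x by (simp add: words_def)
      then have "?\<phi> (?cl [(x, True)]) = b"
        using x e_closed by (auto simp: free_lift_class[OF e_closed])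
      then show "b \<in> ?\<phi> ` carrier ?F"
        using w carrier_F by blast
    qed
    then have "generate G B \<subseteq> ?\<phi> ` carrier ?F"
      by (rule generate_subgroup_incl) (rule \<phi>.img_is_subgroup)
    then show "carrier G \<subseteq> ?\<phi> ` carrier ?F"
      using assms by simp
  qed
  then have "?F Mod kernel ?F G ?\<phi> \<cong> G"
    by (rule \<phi>.FactGroup_iso)
  \<comment> \<open>The relators have value \<open>\<one>\<close>, which gives one inclusion; the
    other one needs the extension property.\<close>
  moreover have "kernel ?F G ?\<phi> = normal_closure ?F R"
  proof
    have "R \<subseteq> kernel ?F G ?\<phi>"
    proof
      fix r assume r: "r \<in> R"
      then obtain x y z where x: "x \<in> Y" "y \<in> Y" "z \<in> Y" "e x \<otimes> e y = e z" "r = ?cl (rel x y z)"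
        by (auto simp: R_def)
      have xyz: "e x \<in> carrier G" "e y \<in> carrier G" "e z \<in> carrier G"
        using x e_closed by auto
      have "?\<phi> r = e x \<otimes> e y \<otimes> inv e z"
        using x(1,2,3,5) xyz free_lift_class[OF e_closed rel_words[of x y z]]
        by (simp add: rel_def m_assoc)
      then have "?\<phi> r = \<one>"
        using x(4) xyz by simp
      then show "r \<in> kernel ?F G ?\<phi>"
        using r R by (auto simp: kernel_def)
    qed
    then show "normal_closure ?F R \<subseteq> kernel ?F G ?\<phi>"
      unfolding normal_closure_def using \<phi>.normal_kernel by blast
    \<comment> \<open>For every normal \<open>N\<close> above \<open>R\<close>, the quotient by
      \<open>N\<close> is a target \<open>H\<close> for \<open>extend\<close>. The resulting
      \<open>f\<close> determines the coset of a word from its value in \<open>G\<close>, so a word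
      of value \<open>\<one>\<close> has its class in \<open>N\<close>.\<close>
    show "kernel ?F G ?\<phi> \<subseteq> normal_closure ?F R"
      unfolding normal_closure_def
    proof (intro Inter_greatest)
      fix N assume "N \<in> {N. N \<lhd> ?F \<and> R \<subseteq> N}"
      then have "N \<lhd> ?F" "R \<subseteq> N" by auto
      interpret N: normal N ?F by fact
      define H where "H = ?F Mod N"
      define co where "co w = N #>\<^bsub>?F\<^esub> ?cl w" for w
      interpret H: group H unfolding H_def by (rule N.factorgroup_is_group)
      interpret co: group_hom ?F H "\<lambda>X. N #>\<^bsub>?F\<^esub> X"
        unfolding H_def
        by (intro group_hom.intro group_hom_axioms.intro N.r_coset_hom_Mod group_free_group H.is_group[unfolded H_def])
      have co_closed: "co w \<in> carrier H" if "w \<in> words Y" for w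
        using that carrier_F unfolding co_def by (intro co.hom_closed) blast
      have co_append: "co (u @ v) = co u \<otimes>\<^bsub>H\<^esub> co v" if "u \<in> words Y" "v \<in> words Y" for u v
        using that carrier_F co.hom_mult[of "?cl u" "?cl v"] free_group_mult[of u Y v]
        unfolding co_def by metis
      have co_Nil: "co [] = \<one>\<^bsub>H\<^esub>"
        using co.hom_one by (simp add: co_def one_F)
      have co_iff: "co w = \<one>\<^bsub>H\<^esub> \<longleftrightarrow> ?cl w \<in> N" if "w \<in> words Y" for w
      proof -
        have "?cl w \<in> carrier ?F" using that carrier_F by blast
        then show ?thesis
          unfolding co_def H_def FactGroup_def monoid.simps
          using group.coset_join1[OF group_free_group[of Y], of N "?cl w"]
            group.coset_join2[OF group_free_group[of Y], of "?cl w" N] N.is_subgroup by auto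
      qed
      have single: "[(x, b)] \<in> words Y" if "x \<in> Y" for x b
        using that by (simp add: words_def)
      have co_inv: "co [(x, True)] \<otimes>\<^bsub>H\<^esub> co [(x, False)] = \<one>\<^bsub>H\<^esub>"
        "co [(x, False)] \<otimes>\<^bsub>H\<^esub> co [(x, True)] = \<one>\<^bsub>H\<^esub>" if "x \<in> Y" for x
      proof -
        have "?cl [(x, b), (x, \<not> b)] = ?cl []" for b
          using equiv_class_eq[OF equiv_free_rel free_rel.cancel[of "[]" Y "[]" x b]] that
          by (simp add: words_Nil)
        then have "co [(x, b), (x, \<not> b)] = \<one>\<^bsub>H\<^esub>" for b
          by (metis co_def co_Nil)
        then show "co [(x, True)] \<otimes>\<^bsub>H\<^esub> co [(x, False)] = \<one>\<^bsub>H\<^esub>"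
          "co [(x, False)] \<otimes>\<^bsub>H\<^esub> co [(x, True)] = \<one>\<^bsub>H\<^esub>"
          using co_append[OF single single] that by (metis append_Cons append_Nil)+
      qed
      define ix where "ix = inv_into Y e"
      have ix: "ix b \<in> Y" "e (ix b) = b" if "b \<in> B" for b
        using that e unfolding ix_def
        by (metis bij_betw_imp_surj_on inv_into_into, metis bij_betw_inv_into_right)
      have ix_e: "ix (e x) = x" if "x \<in> Y" for x
        using that e unfolding ix_def by (metis bij_betw_inv_into_left)
      \<comment> \<open>An element of \<open>B\<close> goes to the coset of the generator naming it;
        as the relators lie in \<open>N\<close>, this respects products inside
        \<open>B\<close>.\<close>
      define \<psi> where "\<psi> b = co [(ix b, True)]" for b
      have \<psi>_closed: "\<psi> b \<in> carrier H" if "b \<in> B" for b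
        using that ix single co_closed by (simp add: \<psi>_def)
      have \<psi>_mult: "\<psi> (b \<otimes> c) = \<psi> b \<otimes>\<^bsub>H\<^esub> \<psi> c" if bc: "b \<in> B" "c \<in> B" "b \<otimes> c \<in> B" for b c
      proof -
        let ?x = "ix b" and ?y = "ix c" and ?z = "ix (b \<otimes> c)"
        have xyz: "?x \<in> Y" "?y \<in> Y" "?z \<in> Y" using bc ix by auto
        have "(?x, ?y, ?z) \<in> {(x, y, z) \<in> Y \<times> Y \<times> Y. e x \<otimes> e y = e z}"
          using bc ix by simp
        then have "?cl (rel ?x ?y ?z) \<in> R" unfolding R_def by (intro image_eqI[of _ _ "(?x, ?y, ?z)"]) simp_all
        then have "co (rel ?x ?y ?z) = \<one>\<^bsub>H\<^esub>"
          using co_iff[OF rel_words] xyz \<open>R \<subseteq> N\<close> by blast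
        moreover have "rel ?x ?y ?z = [(?x, True)] @ [(?y, True)] @ [(?z, False)]"
          by (simp add: rel_def)
        ultimately have "\<psi> b \<otimes>\<^bsub>H\<^esub> (\<psi> c \<otimes>\<^bsub>H\<^esub> co [(?z, False)]) = \<one>\<^bsub>H\<^esub>"
          using co_append single xyz by (simp only: \<psi>_def words_append simp_thms)
        then have "\<psi> b \<otimes>\<^bsub>H\<^esub> \<psi> c \<otimes>\<^bsub>H\<^esub> co [(?z, False)] = \<one>\<^bsub>H\<^esub>"
          using bc \<psi>_closed co_closed single xyz by (simp add: H.m_assoc)
        moreover have "\<psi> (b \<otimes> c) \<otimes>\<^bsub>H\<^esub> co [(?z, False)] = \<one>\<^bsub>H\<^esub>"
          using co_inv xyz by (simp add: \<psi>_def)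
        ultimately show ?thesis
          using H.right_cancel[of "co [(?z, False)]" "\<psi> (b \<otimes> c)" "\<psi> b \<otimes>\<^bsub>H\<^esub> \<psi> c"]
            bc \<psi>_closed co_closed single xyz by simp
      qed
      obtain f where f: "f \<one> = \<one>\<^bsub>H\<^esub>" "\<And>g. g \<in> carrier G \<Longrightarrow> f g \<in> carrier H"
        "\<And>g b. g \<in> carrier G \<Longrightarrow> b \<in> B \<Longrightarrow> f (g \<otimes> b) = f g \<otimes>\<^bsub>H\<^esub> \<psi> b"
        using extend[of H \<psi>, OF H.is_group \<psi>_closed \<psi>_mult] by blast
      \<comment> \<open>\<open>extend\<close> covers only right multiplication by \<open>B\<close>.
        For an inverse letter it is applied at \<open>g \<otimes> inv e x\<close> and solved for the
        value there.\<close>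
      have letter: "f (g \<otimes> letter_value G e (x, b)) = f g \<otimes>\<^bsub>H\<^esub> co [(x, b)]"
        if "x \<in> Y" "g \<in> carrier G" for g x b
      proof -
        have ex: "e x \<in> B" "e x \<in> carrier G" "\<psi> (e x) = co [(x, True)]"
          using that eB e_closed ix_e by (auto simp: \<psi>_def)
        show ?thesis
        proof (cases b)
          case True
          then show ?thesis using f(3)[of g "e x"] that ex by simp
        next
          case False
          let ?h = "g \<otimes> inv e x"
          have h: "?h \<in> carrier G" "?h \<otimes> e x = g"
            using that ex by (auto simp: m_assoc)
          then have "f g = f ?h \<otimes>\<^bsub>H\<^esub> co [(x, True)]"
            using f(3)[of ?h "e x"] ex by simp
          then have "f g \<otimes>\<^bsub>H\<^esub> co [(x, False)] = f ?h"
            using f(2)[OF h(1)] co_closed single that co_inv by (simp add: H.m_assoc)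
          then show ?thesis using False by simp
        qed
      qed
      \<comment> \<open>The base point \<open>g\<close> stays arbitrary because the first letter
        moves it before the induction hypothesis is used.\<close>
      have word: "f (g \<otimes> free_value G e w) = f g \<otimes>\<^bsub>H\<^esub> co w"
        if "w \<in> words Y" "g \<in> carrier G" for w g
        using that
      proof (induction w arbitrary: g)
        case Nil
        then show ?case using f(2)[of g] by (simp add: co_Nil)
      next
        case (Cons l w)
        obtain x b where l: "l = (x, b)" by force
        have w: "x \<in> Y" "w \<in> words Y" "letter_value G e l \<in> carrier G"
          using Cons.prems e_closed by (auto simp: l words_def)
        then have "f (g \<otimes> free_value G e (l # w)) = f (g \<otimes> letter_value G e l) \<otimes>\<^bsub>H\<^esub> co w"
          using Cons free_value_closed[OF e_closed] by (simp add: m_assoc[symmetric])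
        also have "\<dots> = f g \<otimes>\<^bsub>H\<^esub> (co [l] \<otimes>\<^bsub>H\<^esub> co w)"
          using letter[of x g b] w Cons.prems f(2)[of g] co_closed single by (simp add: l H.m_assoc)
        also have "co [l] \<otimes>\<^bsub>H\<^esub> co w = co (l # w)"
          using co_append[of "[l]" w] w single by (simp add: l)
        finally show ?case .
      qed
      show "kernel ?F G ?\<phi> \<subseteq> N"
      proof
        fix X assume X: "X \<in> kernel ?F G ?\<phi>"
        then obtain w where w: "w \<in> words Y" "X = ?cl w"
          using carrier_F by (auto simp: kernel_def)
        then have "free_value G e w = \<one>"
          using X free_lift_class[OF e_closed w(1)] by (simp add: kernel_def)
        \<comment> \<open>At base point \<open>\<one>\<close>, \<open>word\<close> compares
          \<open>f \<one>\<close> with \<open>co w\<close>, and \<open>f \<one>\<close> is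
          trivial.\<close>
        then have "co w = \<one>\<^bsub>H\<^esub>"
          using word[OF w(1) one_closed] f co_closed[OF w(1)] by simp
        then show "X \<in> N" using co_iff w by simp
      qed
    qed
  qed
  ultimately have "?F Mod normal_closure ?F R \<cong> G" by simp
  moreover have "group (?F Mod normal_closure ?F R)"
    using \<open>kernel ?F G ?\<phi> = normal_closure ?F R\<close> \<phi>.normal_kernel normal.factorgroup_is_group
    by metis
  ultimately have "G \<cong> ?F Mod normal_closure ?F R"
    by (rule group.iso_sym[rotated])
  then show ?thesis
    unfolding finitely_presented_def using R by (intro exI[of _ Y] exI[of _ R]) (simp add: Y_def)
qed

end

section \<open>Word length\<close>

locale fg_group = group +
  fixes A
  assumes finite_generators: "finite A"
    and generators_closed: "A \<subseteq> carrier G"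
    and generate_eq: "generate G A = carrier G"
begin

abbreviation "letters \<equiv> A \<union> m_inv G ` A"
abbreviation "eval_word w \<equiv> foldr (\<otimes>) w \<one>"
abbreviation "wl \<equiv> word_length G A"
abbreviation "wd \<equiv> word_dist G A"
abbreviation "lng \<equiv> len G A"

lemma letters_closed: "letters \<subseteq> carrier G"
  using generators_closed by auto

lemma eval_word_closed: "set w \<subseteq> carrier G \<Longrightarrow> eval_word w \<in> carrier G"
  by (induction w) auto

lemma eval_word_append:
  "set v \<subseteq> carrier G \<Longrightarrow> set w \<subseteq> carrier G \<Longrightarrow> eval_word (v @ w) = eval_word v \<otimes> eval_word w"
  by (induction v) (auto simp: eval_word_closed m_assoc)

lemma eval_word_inv:
  "set w \<subseteq> carrier G \<Longrightarrow> eval_word (rev (map (m_inv G) w)) = inv (eval_word w)"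
proof (induction w)
  case (Cons x w)
  have "set (rev (map (m_inv G) w)) \<subseteq> carrier G" "set [inv x] \<subseteq> carrier G"
    using Cons.prems by auto
  then show ?case
    using Cons by (simp add: eval_word_append eval_word_closed inv_mult_group del: foldr_append)
qed simp

lemma ex_word:
  assumes "g \<in> carrier G"
  shows "\<exists>w. set w \<subseteq> letters \<and> eval_word w = g"
proof -
  have "g \<in> generate G A" using assms generate_eq by simp
  then show ?thesis
  proof induction
    case one
    show ?case by (intro exI[of _ "[]"]) simp
  next
    case (incl h)
    then show ?case using generators_closed by (intro exI[of _ "[h]"]) auto
  next
    case (inv h)
    then show ?case using generators_closed by (intro exI[of _ "[inv h]"]) auto
  next
    case (eng g h)
    then obtain v w where "set v \<subseteq> letters" "eval_word v = g" "set w \<subseteq> letters" "eval_word w = h"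
      by blast
    then show ?case
      using letters_closed eval_word_append[of v w] by (intro exI[of _ "v @ w"]) auto
  qed
qed

section \<open>Words of minimal length\<close>

lemma word_length_attained:
  assumes "g \<in> carrier G"
  obtains w where "length w = wl g" "set w \<subseteq> letters" "eval_word w = g"
proof -
  have "\<exists>n w. length w = n \<and> set w \<subseteq> letters \<and> eval_word w = g"
    using ex_word[OF assms] by blast
  then have "\<exists>w. length w = wl g \<and> set w \<subseteq> letters \<and> eval_word w = g"
    unfolding word_length_def by (rule LeastI_ex)
  then show ?thesis by (elim exE conjE) (rule that)
qed

lemma word_length_le: "set w \<subseteq> letters \<Longrightarrow> eval_word w = g \<Longrightarrow> wl g \<le> length w"
  unfolding word_length_def by (rule Least_le) (intro exI[of _ w] conjI, simp_all)

lemma word_length_one: "wl \<one> = 0"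
  using word_length_le[of "[]" \<one>] by simp

lemma word_length_eq_0:
  assumes "g \<in> carrier G"
  shows "wl g = 0 \<longleftrightarrow> g = \<one>"
proof -
  obtain w where "length w = wl g" "eval_word w = g"
    using word_length_attained assms by blast
  then show ?thesis
    using word_length_one by auto
qed

lemma word_length_letter: "x \<in> letters \<Longrightarrow> wl x \<le> 1"
  using word_length_le[of "[x]" x] letters_closed by auto

lemma word_length_mult:
  assumes "g \<in> carrier G" "h \<in> carrier G"
  shows "wl (g \<otimes> h) \<le> wl g + wl h"
proof -
  obtain v where v: "length v = wl g" "set v \<subseteq> letters" "eval_word v = g"
    using word_length_attained assms by blast
  obtain w where w: "length w = wl h" "set w \<subseteq> letters" "eval_word w = h"
    using word_length_attained assms by blast
  have "eval_word (v @ w) = g \<otimes> h"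
    using v w letters_closed eval_word_append[of v w] by blast
  then show ?thesis
    using word_length_le[of "v @ w" "g \<otimes> h"] v w by simp
qed

lemma word_length_inv_le:
  assumes "g \<in> carrier G"
  shows "wl (inv g) \<le> wl g"
proof -
  obtain w where w: "length w = wl g" "set w \<subseteq> letters" "eval_word w = g"
    using word_length_attained assms by blast
  have "eval_word (rev (map (m_inv G) w)) = inv g"
    using w letters_closed eval_word_inv[of w] by blast
  moreover have "set (rev (map (m_inv G) w)) \<subseteq> letters"
    using w generators_closed by (auto simp: image_iff subset_iff)
  ultimately show ?thesis
    using word_length_le[of "rev (map (m_inv G) w)" "inv g"] w by simp
qed

lemma word_length_inv: "g \<in> carrier G \<Longrightarrow> wl (inv g) = wl g"
  using word_length_inv_le[of g] word_length_inv_le[of "inv g"] by simp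

text \<open>The last letter of a shortest word is cut off. The remaining prefix is again shortest,
  because one letter changes the length by at most 1.\<close>

lemma word_length_Suc:
  assumes "g \<in> carrier G" "wl g = Suc n"
  obtains x h where "x \<in> letters" "h \<in> carrier G" "g = h \<otimes> x" "wl h = n"
proof -
  obtain w where w: "length w = wl g" "set w \<subseteq> letters" "eval_word w = g"
    using word_length_attained assms by blast
  then obtain v x where v: "w = v @ [x]"
    using assms by (cases w rule: rev_cases) auto
  let ?h = "eval_word v"
  have x: "x \<in> letters" "x \<in> carrier G" and "set v \<subseteq> carrier G"
    using w v letters_closed by auto
  then have h: "?h \<in> carrier G" "g = ?h \<otimes> x"
    using eval_word_closed[of v] eval_word_append[of v "[x]"] w v by auto
  have "wl ?h \<le> n"
    using word_length_le[of v ?h] w v assms by simp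
  moreover have "Suc n \<le> wl ?h + 1"
    using word_length_mult[OF h(1) x(2)] word_length_letter[OF x(1)] h assms by simp
  ultimately show ?thesis
    using that[of x ?h] x h by simp
qed

text \<open>There are finitely many words of bounded length over the finite set of letters. This
  makes the generating set of the presentation finite.\<close>

lemma finite_ball: "finite {g \<in> carrier G. wl g \<le> n}"
proof (rule finite_subset)
  show "{g \<in> carrier G. wl g \<le> n} \<subseteq> eval_word ` {w. set w \<subseteq> letters \<and> length w \<le> n}"
  proof
    fix g assume g: "g \<in> {g \<in> carrier G. wl g \<le> n}"
    then obtain w where "length w = wl g" "set w \<subseteq> letters" "eval_word w = g"
      using word_length_attained by blast
    then show "g \<in> eval_word ` {w. set w \<subseteq> letters \<and> length w \<le> n}"
      using g by (intro image_eqI[of _ _ w]) simp_all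
  qed
  show "finite (eval_word ` {w. set w \<subseteq> letters \<and> length w \<le> n})"
    using finite_generators by (intro finite_imageI finite_lists_length_le) simp
qed

section \<open>The word metric on the group\<close>

lemma len_eq_word_length: "g \<in> carrier G \<Longrightarrow> lng g = wl g"
  by (simp add: len_def word_dist_def word_length_inv)

lemma word_dist_refl: "g \<in> carrier G \<Longrightarrow> wd g g = 0"
  by (simp add: word_dist_def word_length_one)

lemma word_dist_eq_0:
  assumes "g \<in> carrier G" "h \<in> carrier G"
  shows "wd g h = 0 \<longleftrightarrow> g = h"
  using assms inv_solve_left'[of \<one> g h] by (auto simp: word_dist_def word_length_eq_0)

lemma word_dist_commute:
  assumes "g \<in> carrier G" "h \<in> carrier G"
  shows "wd g h = wd h g"
  using assms word_length_inv[of "inv g \<otimes> h"] by (simp add: word_dist_def inv_mult_group)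

lemma inv_mult_telescope:
  assumes "g \<in> carrier G" "h \<in> carrier G" "k \<in> carrier G"
  shows "(inv g \<otimes> h) \<otimes> (inv h \<otimes> k) = inv g \<otimes> k"
proof -
  have "h \<otimes> (inv h \<otimes> k) = k"
    using assms by (simp add: m_assoc[symmetric])
  then show ?thesis
    using assms by (simp add: m_assoc)
qed

lemma word_dist_triangle:
  assumes "g \<in> carrier G" "h \<in> carrier G" "k \<in> carrier G"
  shows "wd g k \<le> wd g h + wd h k"
  using assms word_length_mult[of "inv g \<otimes> h" "inv h \<otimes> k"]
  by (simp add: word_dist_def inv_mult_telescope)

lemma word_dist_mult_right: "g \<in> carrier G \<Longrightarrow> x \<in> carrier G \<Longrightarrow> wd g (g \<otimes> x) = wl x"
  by (simp add: word_dist_def m_assoc[symmetric])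

text \<open>Dropping the last letter of a shortest word gives the penultimate point of a geodesic
  from \<open>\<one>\<close> to \<open>g\<close>.\<close>

lemma ex_closer_neighbour:
  assumes "g \<in> carrier G" "g \<noteq> \<one>"
  obtains h where "h \<in> carrier G" "lng h < lng g" "wd h g \<le> 1"
proof -
  obtain n where "wl g = Suc n"
    using assms word_length_eq_0 by (metis not0_implies_Suc)
  then obtain x h where "x \<in> letters" "h \<in> carrier G" "g = h \<otimes> x" "wl h = n"
    using assms word_length_Suc by blast
  moreover have "x \<in> carrier G" using \<open>x \<in> letters\<close> letters_closed by blast
  ultimately show ?thesis
    using that[of h] \<open>wl g = Suc n\<close> word_length_letter
    by (simp add: len_eq_word_length word_dist_mult_right)
qed

section \<open>Walks in the Cayley graph\<close>

lemma wf_digraph_cayley_graph: "wf_digraph (cayley_graph G A)"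
  by unfold_locales (auto simp: cayley_graph_def)

text \<open>A shortest word for \<open>inv g \<otimes> h\<close>, read letter by letter from
  \<open>g\<close>, traces the walk.\<close>

lemma ex_geodesic_walk:
  assumes "g \<in> carrier G" "h \<in> carrier G"
  shows "\<exists>p. pre_digraph.awalk (cayley_graph G A) g p h \<and> length p = wd g h"
proof -
  interpret C: wf_digraph "cayley_graph G A" by (rule wf_digraph_cayley_graph)
  have "\<exists>p. C.awalk g p (g \<otimes> k) \<and> length p = wl k" if "k \<in> carrier G" for k
    using that
  proof (induction "wl k" arbitrary: k)
    case 0
    then have "k = \<one>" by (simp add: word_length_eq_0)
    then show ?case
      using assms by (intro exI[of _ "[]"])
        (simp add: C.awalk_Nil_iff word_length_one, simp add: cayley_graph_def)
  next
    case (Suc n)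
    then obtain x m where m: "x \<in> letters" "m \<in> carrier G" "k = m \<otimes> x" "wl m = n"
      using word_length_Suc by metis
    obtain p where p: "C.awalk g p (g \<otimes> m)" "length p = n"
      using Suc m by blast
    have x: "x \<in> carrier G" using m letters_closed by blast
    \<comment> \<open>The graph has no loops, so an arc needs distinct ends; \<open>m\<close> and
      \<open>k\<close> differ because their lengths are \<open>n\<close> and
      \<open>Suc n\<close>.\<close>
    have "g \<otimes> m \<noteq> g \<otimes> k"
      using assms Suc m by auto
    \<comment> \<open>An inverse generator follows an edge backwards, which is the second
      alternative.\<close>
    moreover have "(\<exists>y\<in>A. g \<otimes> k = g \<otimes> m \<otimes> y \<or> g \<otimes> m = g \<otimes> k \<otimes> y)"
      using m(1)
    proof
      assume "x \<in> A"
      then show ?thesis using assms m x by (intro bexI[of _ x]) (simp_all add: m_assoc)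
    next
      assume "x \<in> m_inv G ` A"
      then obtain y where y: "y \<in> A" "x = inv y" "y \<in> carrier G"
        using generators_closed by blast
      then show ?thesis using assms m by (intro bexI[of _ y]) (simp_all add: m_assoc)
    qed
    ultimately have "(g \<otimes> m, g \<otimes> k) \<in> arcs (cayley_graph G A)"
      using assms Suc m by (simp add: cayley_graph_def)
    then have "C.awalk (g \<otimes> m) [(g \<otimes> m, g \<otimes> k)] (g \<otimes> k)"
      using C.arc_implies_awalk by (fastforce simp: cayley_graph_def)
    with p have "C.awalk g (p @ [(g \<otimes> m, g \<otimes> k)]) (g \<otimes> k)"
      using C.awalk_appendI by blast
    then show ?case using p Suc by (intro exI[of _ "p @ [(g \<otimes> m, g \<otimes> k)]"]) simp
  qed
  from this[of "inv g \<otimes> h"] show ?thesis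
    using assms by (simp add: word_dist_def m_assoc[symmetric])
qed

text \<open>Geodesics from \<open>g\<close> to \<open>g'\<close>, on to \<open>\<one>\<close> and
  back to \<open>g\<close> form a closed walk of length \<open>wd g g' + 2 * lng g\<close>.\<close>

lemma even_dist_if_no_odd_cycle:
  assumes no_odd: "\<nexists>p. pre_digraph.cycle (cayley_graph G A) p \<and> odd (length p)"
    and g: "g \<in> carrier G" "g' \<in> carrier G" "lng g = lng g'"
  shows "even (wd g g')"
proof (rule ccontr)
  interpret C: wf_digraph "cayley_graph G A" by (rule wf_digraph_cayley_graph)
  assume odd: "odd (wd g g')"
  obtain p q r where "C.awalk g p g'" "length p = wd g g'" "C.awalk g' q \<one>" "length q = wd g' \<one>"
    "C.awalk \<one> r g" "length r = wd \<one> g"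
    using g ex_geodesic_walk one_closed by metis
  then have "C.awalk g (p @ q @ r) g" "length (p @ q @ r) = wd g g' + 2 * lng g"
    using C.awalk_appendI g word_dist_commute[of \<one> g] by (blast, simp add: len_def)
  then show False
    using C.odd_closed_walk_imp_odd_cycle[of g "p @ q @ r"] no_odd odd by auto
qed

section \<open>Extending local homomorphisms\<close>

lemma diam_le_iff:
  assumes "finite S" "S \<noteq> {}"
  shows "real (diam G A S) \<le> t \<longleftrightarrow> (\<forall>x\<in>S. \<forall>y\<in>S. real (wd x y) \<le> t)"
proof -
  let ?D = "{wd g g' | g g'. g \<in> S \<and> g' \<in> S}"
  have "?D = (\<lambda>(g, g'). wd g g') ` (S \<times> S)" by auto
  then have D: "finite ?D" "?D \<noteq> {}" using assms by auto
  have "diam G A S \<in> ?D"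
    unfolding diam_def by (rule Max_in[OF D])
  then obtain x0 y0 where max: "x0 \<in> S" "y0 \<in> S" "diam G A S = wd x0 y0"
    by blast
  have le: "wd x y \<le> diam G A S" if "x \<in> S" "y \<in> S" for x y
    unfolding diam_def using D(1) that by (intro Max_ge) auto
  show ?thesis
  proof (intro iffI ballI)
    fix x y assume "real (diam G A S) \<le> t" "x \<in> S" "y \<in> S"
    then show "real (wd x y) \<le> t" using le[of x y] by linarith
  next
    assume "\<forall>x\<in>S. \<forall>y\<in>S. real (wd x y) \<le> t"
    then show "real (diam G A S) \<le> t" using max by simp
  qed
qed

text \<open>Meant for one element or two of equal length. Then \<open>len_min\<close> of
  \<open>S\<close> is the common length \<open>l\<close>, and a member of \<open>S'\<close> shorter
  than \<open>l\<close> cannot lie in \<open>S\<close>, so the inclusion is proper.\<close>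

lemma D_poset_iff:
  assumes "S \<noteq> {}" "\<And>g. g \<in> S \<Longrightarrow> lng g = l"
  shows "S' \<in> D_poset G A t S \<longleftrightarrow> finite S' \<and> S' \<subseteq> carrier G \<and> S \<subseteq> S' \<and>
    (\<forall>x\<in>S'. \<forall>y\<in>S'. real (wd x y) \<le> t) \<and> (\<exists>h\<in>S'. lng h < l)"
proof (cases "finite S' \<and> S \<subseteq> S'")
  case True
  then have "lng ` S = {l}" using assms by force
  then have S: "len_min G A S = l" by (simp add: len_min_def)
  have S': "finite S'" "S' \<noteq> {}" using True assms(1) by auto
  then have low: "len_min G A S' < l \<longleftrightarrow> (\<exists>h\<in>S'. lng h < l)"
    unfolding len_min_def by (subst Min_less_iff) auto
  have "S \<subset> S'" if "h \<in> S'" "lng h < l" for h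
    using that True assms(2)[of h] by blast
  then show ?thesis
    unfolding D_poset_def mem_Collect_eq S low diam_le_iff[OF S'] using True by blast
qed (auto simp: D_poset_def)

lemma common_closer_neighbour:
  assumes "1 \<le> t"
    and nonempty: "int (wd g g') = \<lfloor>t\<rfloor> \<Longrightarrow> topspace (D_complex G A t {g, g'}) \<noteq> {}"
    and g: "g \<in> carrier G" "g' \<in> carrier G" "g \<noteq> g'" "lng g = lng g'" "real (wd g g') \<le> t"
  shows "\<exists>h\<in>carrier G. lng h < lng g \<and> real (wd h g) \<le> t \<and> real (wd h g') \<le> t"
proof (cases "int (wd g g') = \<lfloor>t\<rfloor>")
  case True
  have "D_poset G A t {g, g'} \<noteq> {}"
    by (rule realization_order_complex_nonempty[OF nonempty[OF True, unfolded D_complex_def]])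
  then obtain S where S: "S \<in> D_poset G A t {g, g'}"
    by auto
  have "S \<in> D_poset G A t {g, g'} \<longleftrightarrow> finite S \<and> S \<subseteq> carrier G \<and> {g, g'} \<subseteq> S \<and>
    (\<forall>x\<in>S. \<forall>y\<in>S. real (wd x y) \<le> t) \<and> (\<exists>h\<in>S. lng h < lng g)"
    using g(4) by (intro D_poset_iff) auto
  with S obtain h where "h \<in> S" "lng h < lng g" "S \<subseteq> carrier G" "{g, g'} \<subseteq> S"
    "\<forall>x\<in>S. \<forall>y\<in>S. real (wd x y) \<le> t"
    by (elim iffE) metis
  then show ?thesis
    by (intro bexI[of _ h]) auto
next
  case False
  \<comment> \<open>Distances are integers, so one that is at most \<open>t\<close> and differs from
    \<open>\<lfloor>t\<rfloor>\<close> leaves room for one more step.\<close>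
  then have less: "real (wd g g') + 1 \<le> t"
    using g(5) by linarith
  have "wl g = wl g'"
    using g(1,2,4) by (simp add: len_eq_word_length)
  \<comment> \<open>Only \<open>\<one>\<close> has length 0, and \<open>g'\<close> is a different
    element of the same length.\<close>
  then have "g \<noteq> \<one>"
    using g(2,3) word_length_eq_0[of g'] word_length_one by auto
  then obtain h where h: "h \<in> carrier G" "lng h < lng g" "wd h g \<le> 1"
    using ex_closer_neighbour[OF g(1)] by blast
  have "wd h g' \<le> wd g g' + 1"
    using word_dist_triangle[of h g g'] h g(1,2) by simp
  then have "real (wd h g') \<le> t" "real (wd h g) \<le> t"
    using h(3) less \<open>1 \<le> t\<close> by linarith+
  then show ?thesis
    using h(1,2) by (intro bexI[of _ h]) simp_all
qed

lemma local_hom_extends: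
  fixes H :: "('h, 'm) monoid_scheme" and t :: real
  assumes "group H" "1 \<le> t"
    and conn: "\<And>g. g \<in> carrier G \<Longrightarrow> g \<noteq> \<one> \<Longrightarrow> zero_connected (D_complex G A t {g})"
    and common: "\<And>g g'. g \<in> carrier G \<Longrightarrow> g' \<in> carrier G \<Longrightarrow> g \<noteq> g' \<Longrightarrow> lng g = lng g' \<Longrightarrow>
      real (wd g g') \<le> t \<Longrightarrow> \<exists>h\<in>carrier G. lng h < lng g \<and> real (wd h g) \<le> t \<and> real (wd h g') \<le> t"
    and B: "B = {g \<in> carrier G. real (wl g) \<le> t}"
    and closed: "\<And>b. b \<in> B \<Longrightarrow> \<psi> b \<in> carrier H"
    and mult: "\<And>b c. b \<in> B \<Longrightarrow> c \<in> B \<Longrightarrow> b \<otimes> c \<in> B \<Longrightarrow> \<psi> (b \<otimes> c) = \<psi> b \<otimes>\<^bsub>H\<^esub> \<psi> c"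
  shows "\<exists>f. f \<one> = \<one>\<^bsub>H\<^esub> \<and> (\<forall>g\<in>carrier G. f g \<in> carrier H) \<and>
    (\<forall>g\<in>carrier G. \<forall>b\<in>B. f (g \<otimes> b) = f g \<otimes>\<^bsub>H\<^esub> \<psi> b)"
proof -
  interpret H: group H by fact
  \<comment> \<open>\<open>e\<close> turns \<open>\<psi>\<close> into a cocycle on pairs within
    distance \<open>t\<close>, with \<open>e_mult\<close> as the rule on triangles; \<open>f\<close>
    will be a potential for it.\<close>
  define e where "e g h = \<psi> (inv g \<otimes> h)" for g h
  define adj where "adj g h \<longleftrightarrow> g \<in> carrier G \<and> h \<in> carrier G \<and> real (wd g h) \<le> t" for g h
  have adj_sym: "adj h g" if "adj g h" for g h
    using that word_dist_commute unfolding adj_def by metis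
  have adj_refl: "adj g g" if "g \<in> carrier G" for g
    using that \<open>1 \<le> t\<close> by (simp add: adj_def word_dist_refl)
  have e_closed: "e g h \<in> carrier H" if "adj g h" for g h
    using that closed by (simp add: e_def adj_def B word_dist_def)
  have e_mult: "e g h \<otimes>\<^bsub>H\<^esub> e h k = e g k" if "adj g h" "adj h k" "adj g k" for g h k
    using that mult[of "inv g \<otimes> h" "inv h \<otimes> k"]
    by (simp add: e_def adj_def B word_dist_def inv_mult_telescope)
  have e_refl: "e g g = \<one>\<^bsub>H\<^esub>" if "g \<in> carrier G" for g
    using e_mult[of g g g] e_closed[of g g] adj_refl[OF that] H.r_cancel_one by metis
  \<comment> \<open>\<open>r\<close> is admissible at \<open>g\<close> if every shorter neighbour
    predicts it. Only values of \<open>f\<close> at shorter elements are consulted, as recursion on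
    the length requires.\<close>
  define good where "good f g r \<longleftrightarrow> r \<in> carrier H \<and> (g = \<one> \<longrightarrow> r = \<one>\<^bsub>H\<^esub>) \<and>
    (\<forall>h. adj h g \<and> lng h < lng g \<longrightarrow> r = f h \<otimes>\<^bsub>H\<^esub> e h g)" for f g r
  \<comment> \<open>Predictions hold along every edge, in both directions. Beyond \<open>h\<close>
    and \<open>k\<close>, only elements shorter than \<open>h\<close> are assumed good, so this can
    be used in the middle of the recursion.\<close>
  have step: "f k = f h \<otimes>\<^bsub>H\<^esub> e h k"
    if h: "adj h k" "good f h (f h)" "good f k (f k)"
      and m: "\<And>m. m \<in> carrier G \<Longrightarrow> lng m < lng h \<Longrightarrow> good f m (f m)" for f h k
  proof -
    have hk: "h \<in> carrier G" "k \<in> carrier G" "f h \<in> carrier H" "f k \<in> carrier H"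
      using h by (auto simp: adj_def good_def)
    consider "lng h < lng k" | "lng k < lng h" | "lng h = lng k" "h \<noteq> k" | "h = k"
      by linarith
    then show ?thesis
    proof cases
      case 1
      then show ?thesis using h by (auto simp: good_def)
    next
      case 2
      then have "f h = f k \<otimes>\<^bsub>H\<^esub> e k h"
        using h adj_sym by (auto simp: good_def)
      then have "f h \<otimes>\<^bsub>H\<^esub> e h k = f k \<otimes>\<^bsub>H\<^esub> (e k h \<otimes>\<^bsub>H\<^esub> e h k)"
        using hk h adj_sym e_closed by (simp add: H.m_assoc)
      then show ?thesis
        using e_mult[of k h k] h hk adj_sym adj_refl e_refl by simp
    next
      \<comment> \<open>Neither end predicts the other; both are predicted by a common shorter
        neighbour \<open>l\<close>, and \<open>l\<close>, \<open>h\<close>, \<open>k\<close> span a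
        triangle.\<close>
      case 3
      then obtain l where l: "lng l < lng h" "adj l h" "adj l k"
        using common[of h k] h hk unfolding adj_def by blast
      then have "f l \<in> carrier H" "f h = f l \<otimes>\<^bsub>H\<^esub> e l h" "f k = f l \<otimes>\<^bsub>H\<^esub> e l k"
        using m[of l] h 3 by (auto simp: good_def adj_def)
      then show ?thesis
        using l h e_closed e_mult[of l h k] by (simp add: H.m_assoc)
    next
      case 4
      then show ?thesis using hk e_refl by simp
    qed
  qed
  have "\<exists>f. \<forall>g. g \<in> carrier G \<longrightarrow> good f g (f g)"
  proof (rule dependent_wf_choice)
    show "wf (inv_image less_than lng)" by (simp add: wf_inv_image)
    show "(g \<in> carrier G \<longrightarrow> good f g r) = (g \<in> carrier G \<longrightarrow> good f' g r)"
      if "\<And>z. (z, g) \<in> inv_image less_than lng \<Longrightarrow> f z = f' z" for f f' g r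
      using that by (auto simp: good_def)
    fix g f
    assume "\<And>h. (h, g) \<in> inv_image less_than lng \<Longrightarrow> h \<in> carrier G \<longrightarrow> good f h (f h)"
    then have IH: "good f h (f h)" if "h \<in> carrier G" "lng h < lng g" for h
      using that by simp
    show "\<exists>r. g \<in> carrier G \<longrightarrow> good f g r"
    proof (cases "g \<in> carrier G \<and> g \<noteq> \<one>")
      \<comment> \<open>Nothing is shorter than \<open>\<one>\<close>, so the identity of
        \<open>H\<close> is admissible there.\<close>
      case False
      then show ?thesis
        by (auto simp: good_def len_eq_word_length word_length_one)
    next
      case True
      let ?P = "D_poset G A t {g}"
      note P_iff = D_poset_iff[of "{g}" "lng g" _ t, simplified]
      \<comment> \<open>\<open>val h\<close> is the value at \<open>g\<close> predicted by
        \<open>h\<close>. Adjacent shorter neighbours predict the same value by \<open>step\<close>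
        and the triangle with \<open>g\<close>.\<close>
      define val where "val h = f h \<otimes>\<^bsub>H\<^esub> e h g" for h
      have val: "val h = val k" if hk: "adj h g" "adj k g" "adj h k" "lng h < lng g" "lng k < lng g" for h k
      proof -
        have G: "h \<in> carrier G" "k \<in> carrier G"
          using hk by (auto simp: adj_def)
        then have "f k = f h \<otimes>\<^bsub>H\<^esub> e h k"
          using hk by (intro step IH) (auto intro: less_trans)
        moreover have "f h \<in> carrier H"
          using IH[of h] hk G by (auto simp: good_def)
        ultimately show ?thesis
          using hk e_closed e_mult[of h k g] by (simp add: val_def H.m_assoc)
      qed
      obtain h0 where h0: "adj h0 g" "lng h0 < lng g"
        using ex_closer_neighbour[of g] True \<open>1 \<le> t\<close> unfolding adj_def by force
      \<comment> \<open>The sets whose shorter members all agree with \<open>h0\<close>. This passes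
        to smaller sets, and to larger ones because a shorter member of the old set is adjacent to
        every member of the new one. Connectedness then makes \<open>C\<close> all of the
        poset.\<close>
      define C where "C = {S \<in> ?P. \<forall>h\<in>S. lng h < lng g \<longrightarrow> val h = val h0}"
      have adjS: "adj h k" if "S \<in> ?P" "h \<in> S" "k \<in> S" for S h k
        using that P_iff by (auto simp: adj_def)
      have pair: "{g, h} \<in> ?P" if "adj h g" "lng h < lng g" for h
        using that adj_sym[of h g] adj_refl[of h] adj_refl[of g] P_iff by (auto simp: adj_def)
      have "C = ?P"
      proof (rule zero_connected_order_complex_components)
        show "zero_connected (realization (order_complex ?P))"
          using conn[of g] True by (simp add: D_complex_def)
        show "C \<subseteq> ?P" by (auto simp: C_def)
        show "{g, h0} \<in> C"
          using pair h0 by (auto simp: C_def)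
        fix S S' assume S: "S \<in> C" "S' \<in> ?P"
        show "S' \<in> C" if "S' \<subseteq> S"
          using that S by (auto simp: C_def)
        show "S' \<in> C" if "S \<subseteq> S'"
        proof -
          obtain k where k: "k \<in> S" "lng k < lng g" "val k = val h0"
            using S P_iff by (auto simp: C_def)
          have "val h = val h0" if "h \<in> S'" "lng h < lng g" for h
            using val[of h k] k that adjS[OF S(2)] \<open>S \<subseteq> S'\<close> S(2) P_iff by (metis subsetD)
          then show ?thesis using S by (simp add: C_def)
        qed
      qed
      \<comment> \<open>Every shorter neighbour occurs in a member of the poset, namely its pair
        with \<open>g\<close>.\<close>
      then have "val h = val h0" if "adj h g" "lng h < lng g" for h
      proof -
        have "{g, h} \<in> C" using pair[OF that] \<open>C = ?P\<close> by simp
        then show ?thesis using that by (simp add: C_def)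
      qed
      moreover have "val h0 \<in> carrier H"
        using IH[of h0] h0 e_closed by (auto simp: val_def good_def adj_def)
      ultimately have "good f g (val h0)"
        using True by (auto simp: good_def val_def)
      then show ?thesis by blast
    qed
  qed
  then obtain f where f: "\<And>g. g \<in> carrier G \<Longrightarrow> good f g (f g)" by blast
  have "f (g \<otimes> b) = f g \<otimes>\<^bsub>H\<^esub> \<psi> b" if "g \<in> carrier G" "b \<in> B" for g b
  proof -
    have "adj g (g \<otimes> b)" "e g (g \<otimes> b) = \<psi> b"
      using that by (auto simp: adj_def e_def B word_dist_mult_right m_assoc[symmetric])
    then show ?thesis
      using step[of g "g \<otimes> b" f] f that B by simp
  qed
  moreover have "f \<one> = \<one>\<^bsub>H\<^esub>"
    using f[OF one_closed] by (simp add: good_def)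
  ultimately show ?thesis
    using f by (intro exI[of _ f]) (simp add: good_def)
qed

section \<open>From connectivity to a finite presentation\<close>

lemma finitely_presented_if_connected:
  fixes t :: real
  assumes conn: "\<And>g. g \<in> carrier G \<Longrightarrow> g \<noteq> \<one> \<Longrightarrow> zero_connected (D_complex G A t {g})"
    and nonempty: "\<And>g g'. g \<in> carrier G \<Longrightarrow> g' \<in> carrier G \<Longrightarrow> int (wd g g') = \<lfloor>t\<rfloor> \<Longrightarrow>
      lng g = lng g' \<Longrightarrow> topspace (D_complex G A t {g, g'}) \<noteq> {}"
  shows "finitely_presented G"
proof -
  \<comment> \<open>For the trivial group \<open>conn\<close> is vacuous and does not bound
    \<open>t\<close> from below, so the radius is set to 1 there.\<close>
  define s where "s = (if carrier G = {\<one>} then 1 else t)"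
  have nontrivial: "s = t" if "g \<in> carrier G" "g' \<in> carrier G" "g \<noteq> g'" for g g'
    using that by (auto simp: s_def)
  \<comment> \<open>Otherwise some \<open>D\<^sub>t({g})\<close> is non-empty, so an element other
    than \<open>g\<close> lies within distance \<open>t\<close> of \<open>g\<close>.\<close>
  have "1 \<le> s"
  proof (cases "carrier G = {\<one>}")
    case False
    then obtain g where g: "g \<in> carrier G" "g \<noteq> \<one>" using one_closed by blast
    then have "topspace (realization (order_complex (D_poset G A t {g}))) \<noteq> {}"
      using conn by (simp add: zero_connected_def D_complex_def)
    then have "D_poset G A t {g} \<noteq> {}"
      by (rule realization_order_complex_nonempty)
    then obtain S where "S \<in> D_poset G A t {g}" by blast
    then obtain h where "S \<subseteq> carrier G" "h \<in> S" "lng h < lng g" "real (wd h g) \<le> t"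
      using D_poset_iff[of "{g}" "lng g" S t] by auto
    moreover from this have "wd h g \<noteq> 0"
      using word_dist_eq_0[of h g] g by auto
    ultimately show ?thesis using False by (simp add: s_def)
  qed (simp add: s_def)
  define B where "B = {g \<in> carrier G. real (wl g) \<le> s}"
  show ?thesis
  proof (rule finitely_presentedI)
    have "B \<subseteq> {g \<in> carrier G. wl g \<le> nat \<lfloor>s\<rfloor>}"
      by (auto simp: B_def le_nat_floor)
    then show "finite B" by (rule finite_subset) (rule finite_ball)
    show B: "B \<subseteq> carrier G" by (auto simp: B_def)
    \<comment> \<open>The radius is at least 1, so the ball contains the given generators and
      generates \<open>G\<close>.\<close>
    have "A \<subseteq> B"
    proof
      fix x assume "x \<in> A"
      then have "x \<in> carrier G" "wl x \<le> 1"
        using generators_closed word_length_letter by auto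
      then show "x \<in> B" using \<open>1 \<le> s\<close> by (simp add: B_def)
    qed
    then show "generate G B = carrier G"
      using mono_generate[of A B] generate_eq generate_incl[OF B] by auto
  next
    fix H :: "(nat \<times> bool) list set set monoid" and \<psi>
    assume H: "group H" and "\<And>b. b \<in> B \<Longrightarrow> \<psi> b \<in> carrier H"
      and "\<And>b c. b \<in> B \<Longrightarrow> c \<in> B \<Longrightarrow> b \<otimes> c \<in> B \<Longrightarrow> \<psi> (b \<otimes> c) = \<psi> b \<otimes>\<^bsub>H\<^esub> \<psi> c"
    then show "\<exists>f. f \<one> = \<one>\<^bsub>H\<^esub> \<and> (\<forall>g\<in>carrier G. f g \<in> carrier H) \<and>
      (\<forall>g\<in>carrier G. \<forall>b\<in>B. f (g \<otimes> b) = f g \<otimes>\<^bsub>H\<^esub> \<psi> b)"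
    proof (intro local_hom_extends[OF H \<open>1 \<le> s\<close> _ _ B_def])
      show "zero_connected (D_complex G A s {g})" if "g \<in> carrier G" "g \<noteq> \<one>" for g
        using conn[OF that] nontrivial[OF that(1) one_closed that(2)] by simp
      show "\<exists>h\<in>carrier G. lng h < lng g \<and> real (wd h g) \<le> s \<and> real (wd h g') \<le> s"
        if "g \<in> carrier G" "g' \<in> carrier G" "g \<noteq> g'" "lng g = lng g'" "real (wd g g') \<le> s" for g g'
        using that \<open>1 \<le> s\<close> nonempty nontrivial[OF that(1-3)]
        by (intro common_closer_neighbour) simp_all
    qed
  qed
qed

end

text \<open>The largest distance allowed in \<open>D\<^sub>t(S)\<close> is
  \<open>\<lfloor>t\<rfloor>\<close>, which therefore stands for the distance \<open>t\<close> of
  pairs of equal length.\<close>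

theorem theorem3:
  fixes G (structure) and A :: "'a set"
  assumes "group G" and "finite A" and "A \<subseteq> carrier G" and "generate G A = carrier G"
  shows
    "((\<exists>t::real.
         (\<forall>g\<in>carrier G. g \<noteq> \<one> \<longrightarrow> zero_connected (D_complex G A t {g})) \<and>
         (\<forall>g\<in>carrier G. \<forall>g'\<in>carrier G.
            int (word_dist G A g g') = \<lfloor>t\<rfloor> \<and> len G A g = len G A g' \<longrightarrow>
            topspace (D_complex G A t {g, g'}) \<noteq> {}))
      \<longrightarrow> finitely_presented G) \<and>
     ((\<nexists>p. pre_digraph.cycle (cayley_graph G A) p \<and> odd (length p)) \<longrightarrow>
      (\<exists>t::nat. odd t \<and>
         (\<forall>g\<in>carrier G. g \<noteq> \<one> \<longrightarrow> zero_connected (D_complex G A (real t) {g})))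
      \<longrightarrow> finitely_presented G)"
proof -
  interpret group G by fact
  interpret fg_group G A by unfold_locales fact+
  show ?thesis
  proof (intro conjI impI)
    assume "\<exists>t::real.
      (\<forall>g\<in>carrier G. g \<noteq> \<one> \<longrightarrow> zero_connected (D_complex G A t {g})) \<and>
      (\<forall>g\<in>carrier G. \<forall>g'\<in>carrier G. int (wd g g') = \<lfloor>t\<rfloor> \<and> lng g = lng g' \<longrightarrow>
        topspace (D_complex G A t {g, g'}) \<noteq> {})"
    then obtain t :: real where
      "\<forall>g\<in>carrier G. g \<noteq> \<one> \<longrightarrow> zero_connected (D_complex G A t {g})"
      "\<forall>g\<in>carrier G. \<forall>g'\<in>carrier G. int (wd g g') = \<lfloor>t\<rfloor> \<and> lng g = lng g' \<longrightarrow>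
        topspace (D_complex G A t {g, g'}) \<noteq> {}"
      by (elim exE conjE)
    then show "finitely_presented G"
      by (intro finitely_presented_if_connected[of t]) simp_all
  next
    assume no_odd: "\<nexists>p. pre_digraph.cycle (cayley_graph G A) p \<and> odd (length p)"
    assume "\<exists>t::nat. odd t \<and>
      (\<forall>g\<in>carrier G. g \<noteq> \<one> \<longrightarrow> zero_connected (D_complex G A (real t) {g}))"
    then obtain t :: nat where t: "odd t"
      "\<forall>g\<in>carrier G. g \<noteq> \<one> \<longrightarrow> zero_connected (D_complex G A (real t) {g})"
      by (elim exE conjE)
    show "finitely_presented G"
    proof (rule finitely_presented_if_connected[of "real t"])
      fix g g' assume g: "g \<in> carrier G" "g' \<in> carrier G" "lng g = lng g'"
        and dist: "int (wd g g') = \<lfloor>real t\<rfloor>"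
      \<comment> \<open>The distance would be both odd and even, so no such pair exists.\<close>
      have "wd g g' = t" using dist by simp
      moreover have "even (wd g g')" by (rule even_dist_if_no_odd_cycle[OF no_odd g])
      ultimately show "topspace (D_complex G A (real t) {g, g'}) \<noteq> {}"
        using t(1) by simp
    qed (use t(2) in blast)
  qed
qed

end
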